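(* For any integer partition $\lambda$, the sequence $(s_\lambda(1^n))_{n\ge0}$ is log-concave, i.e. $s_\lambda(1^n)^2\ge s_\lambda(1^{n-1})\,s_\lambda(1^{n+1})$ for all $n\ge1$.
   Context: A semistandard Young tableau (SSYT) of shape $\lambda$ is a filling $T$ of the boxes $(i,j)$ of the Young diagram of $\lambda$ with positive integers $T_{i,j}$ such that rows weakly increase left-to-right and columns strictly increase top-to-bottom. The Schur function is $s_\lambda(x_1,x_2,\ldots)=\sum_T\prod_{(i,j)\in\lambda}x_{T_{i,j}}$, the sum being over all SSYT $T$ of shape $\lambda$. $s_\lambda(1^n)$ denotes its value under the specialization $x_i=1$ for $i\le n$ and $x_i=0$ for $i>n$. *)

theory Defs
  imports "HOL-Analysis.Infinite_Sum"
begin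

text \<open>An integer partition is the weakly decreasing list of its (positive) parts.\<close>

definition is_partition :: "nat list \<Rightarrow> bool" where
  "is_partition l \<longleftrightarrow> sorted_wrt (\<ge>) l \<and> 0 \<notin> set l"

text \<open>Rows and columns are numbered from 0, rows from top to bottom.\<close>

definition young_diagram :: "nat list \<Rightarrow> (nat \<times> nat) set" where
  "young_diagram l = {(i, j). i < length l \<and> j < l ! i}"

text \<open>A filling is a total function on pairs; it is required to be 0 off the diagram so that
  distinct elements of \<open>SSYT l\<close> are distinct tableaux.\<close>

definition SSYT :: "nat list \<Rightarrow> (nat \<times> nat \<Rightarrow> nat) set" where
  "SSYT l = {T.
     (\<forall>b. b \<notin> young_diagram l \<longrightarrow> T b = 0) \<and>
     (\<forall>b \<in> young_diagram l. T b \<ge> 1) \<and>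
     (\<forall>i j j'. (i, j) \<in> young_diagram l \<longrightarrow> (i, j') \<in> young_diagram l \<longrightarrow> j < j' \<longrightarrow>
        T (i, j) \<le> T (i, j')) \<and>
     (\<forall>i i' j. (i, j) \<in> young_diagram l \<longrightarrow> (i', j) \<in> young_diagram l \<longrightarrow> i < i' \<longrightarrow>
        T (i, j) < T (i', j))}"

text \<open>The value of the Schur function at \<open>x\<^sub>1 = x 1, x\<^sub>2 = x 2, \<dots>\<close>; the argument \<open>x 0\<close> is never
  used. As usual for \<open>infsum\<close>, this is meaningful only if the family of monomials is summable,
  which is always so when \<open>x\<close> has finite support: see \<open>schur_finite_support\<close>.\<close>

definition schur :: "nat list \<Rightarrow> (nat \<Rightarrow> real) \<Rightarrow> real" where
  "schur l x = (\<Sum>\<^sub>\<infinity>T\<in>SSYT l. \<Prod>b\<in>young_diagram l. x (T b))"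

definition ones :: "nat \<Rightarrow> nat \<Rightarrow> real" where
  "ones n i = (if i \<le> n then 1 else 0)"

lemma finite_young_diagram: "finite (young_diagram l)"
proof -
  have "young_diagram l = (SIGMA i:{..<length l}. {..<l ! i})"
    by (auto simp: young_diagram_def)
  then show ?thesis by simp
qed

lemma schur_finite_support:
  assumes "finite {i. i \<ge> 1 \<and> x i \<noteq> 0}"
  shows "finite {T \<in> SSYT l. (\<Prod>b\<in>young_diagram l. x (T b)) \<noteq> 0}"
    and "(\<lambda>T. \<Prod>b\<in>young_diagram l. x (T b)) summable_on SSYT l"
    and "schur l x =
      (\<Sum>T | T \<in> SSYT l \<and> (\<Prod>b\<in>young_diagram l. x (T b)) \<noteq> 0. \<Prod>b\<in>young_diagram l. x (T b))"
proof -
  let ?f = "\<lambda>T. \<Prod>b\<in>young_diagram l. x (T b)"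
  let ?S = "{T \<in> SSYT l. ?f T \<noteq> 0}"
  let ?F = "{T. \<forall>b. (b \<in> young_diagram l \<longrightarrow> T b \<in> {i. i \<ge> 1 \<and> x i \<noteq> 0}) \<and>
                    (b \<notin> young_diagram l \<longrightarrow> T b = 0)}"
  have "?S \<subseteq> ?F"
    by (auto simp: SSYT_def finite_young_diagram)
  moreover have "finite ?F"
    by (rule finite_set_of_finite_funs[OF finite_young_diagram assms])
  ultimately show fin: "finite ?S"
    by (rule finite_subset)
  have "?f summable_on ?S"
    by (rule summable_on_finite[OF fin])
  also have "?f summable_on ?S \<longleftrightarrow> ?f summable_on SSYT l"
    by (rule summable_on_cong_neutral) auto
  finally show "?f summable_on SSYT l" .
  have "schur l x = infsum ?f ?S"
    unfolding schur_def by (rule infsum_cong_neutral) auto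
  then show "schur l x = sum ?f ?S"
    using fin by simp
qed

end

theory Submission
  imports Defs
begin

text \<open>
  Write \<open>A n\<close> for the set of tableaux of the given shape with entries at most \<open>n\<close>, so that the
  Schur function takes the value \<open>card (A n)\<close> at \<open>ones n\<close>. The conditions on rows and columns of a
  tableau each compare two entries, weakly or strictly, and such conditions survive pointwise
  minima and maxima: the tableaux form a sublattice of the distributive lattice of all fillings. In that
  lattice put the tableaux with entries in \<open>{2..n}\<close>, which are those of \<open>A (n - 1)\<close> raised by one,
  next to those with entries in \<open>{1..n + 1}\<close>. Meets of one of the former with one of the latter have
  entries in \<open>{1..n}\<close>, joins have entries in \<open>{2..n + 1}\<close>, and both of these ranges are counted by
  \<open>card (A n)\<close>.

  Meet and join do not determine the pair that they come from, so this is not yet an injection of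
  \<open>A (n - 1) \<times> A (n + 1)\<close> into \<open>A n \<times> A n\<close>. What replaces the injection is Daykin's inequality
  \<open>card X * card Y \<le> card (X \<and> Y) * card (X \<or> Y)\<close> for finite sets in a distributive lattice
  (\<open>card_mult_le_card_meets_joins\<close>), which is the case of indicator functions in the four functions
  theorem of Ahlswede and Daykin (\<open>four_functions_box\<close>). The latter is proved for products of
  chains: the case of one chain is a two-term inequality, and further factors are added by summing
  over one coordinate at a time.
\<close>

section \<open>The four functions theorem on a product of chains\<close>

text \<open>
  From \<open>(c - a) * (c - b) \<ge> 0\<close> one gets \<open>c * (a + b) \<le> c * c + a * b \<le> c * (c + d)\<close>, which can be
  divided by \<open>c\<close> unless \<open>c = 0\<close>; in that case \<open>a\<close> and \<open>b\<close> vanish.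
\<close>

lemma sum_le_sum_of_mult_le_mult:
  fixes a b c d :: real
  assumes "0 \<le> a" "0 \<le> b" "0 \<le> d" "a \<le> c" "b \<le> c" "a * b \<le> c * d"
  shows "a + b \<le> c + d"
proof (cases "c = 0")
  case True
  then show ?thesis using assms by simp
next
  case False
  then have "c > 0" using assms by linarith
  have "0 \<le> (c - a) * (c - b)" using assms by simp
  then have "c * (a + b) \<le> c * c + a * b" by (simp add: algebra_simps)
  also have "\<dots> \<le> c * (c + d)" using assms by (simp add: algebra_simps)
  finally show ?thesis using \<open>c > 0\<close> by simp
qed

text \<open>
  Expanding both products, the terms for \<open>(i, j)\<close> and \<open>(j, i)\<close> are compared together. With \<open>i \<le> j\<close>,
  each of \<open>\<alpha> i * \<beta> j\<close> and \<open>\<alpha> j * \<beta> i\<close> is at most \<open>\<gamma> i * \<delta> j\<close>, and the two diagonal instances of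
  the hypothesis bound their product, which is what the two-term inequality asks for.
\<close>

lemma four_functions_chain:
  fixes \<alpha> \<beta> \<gamma> \<delta> :: "'b::linorder \<Rightarrow> real"
  assumes nonneg: "\<And>i. 0 \<le> \<alpha> i" "\<And>i. 0 \<le> \<beta> i" "\<And>i. 0 \<le> \<gamma> i" "\<And>i. 0 \<le> \<delta> i"
    and le: "\<And>i j. i \<in> K \<Longrightarrow> j \<in> K \<Longrightarrow> \<alpha> i * \<beta> j \<le> \<gamma> (min i j) * \<delta> (max i j)"
  shows "sum \<alpha> K * sum \<beta> K \<le> sum \<gamma> K * sum \<delta> K"
proof -
  have ordered: "\<alpha> i * \<beta> j + \<alpha> j * \<beta> i \<le> \<gamma> i * \<delta> j + \<gamma> j * \<delta> i"
    if "i \<in> K" "j \<in> K" "i \<le> j" for i j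
  proof (rule sum_le_sum_of_mult_le_mult)
    show "\<alpha> i * \<beta> j \<le> \<gamma> i * \<delta> j" "\<alpha> j * \<beta> i \<le> \<gamma> i * \<delta> j"
      using le[of i j] le[of j i] that by (simp_all add: min_def max_def split: if_splits)
    have "(\<alpha> i * \<beta> i) * (\<alpha> j * \<beta> j) \<le> (\<gamma> i * \<delta> i) * (\<gamma> j * \<delta> j)"
      using le[of i i] le[of j j] that by (intro mult_mono[of "\<alpha> i * \<beta> i"]) (simp_all add: nonneg)
    then show "(\<alpha> i * \<beta> j) * (\<alpha> j * \<beta> i) \<le> (\<gamma> i * \<delta> j) * (\<gamma> j * \<delta> i)"
      by (simp add: mult_ac)
  qed (simp_all add: nonneg)
  have pair: "\<alpha> i * \<beta> j + \<alpha> j * \<beta> i \<le> \<gamma> i * \<delta> j + \<gamma> j * \<delta> i"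
    if "i \<in> K" "j \<in> K" for i j
    using ordered[of i j] ordered[of j i] that by (cases i j rule: le_cases) simp_all
  have double: "2 * (sum f K * sum g K) = (\<Sum>i\<in>K. \<Sum>j\<in>K. f i * g j + f j * g i)"
    for f g :: "'b \<Rightarrow> real"
  proof -
    have "(\<Sum>i\<in>K. \<Sum>j\<in>K. f j * g i) = sum f K * sum g K"
      by (subst sum.swap) (simp add: sum_product)
    then show ?thesis by (simp add: sum.distrib sum_product)
  qed
  have "2 * (sum \<alpha> K * sum \<beta> K) \<le> 2 * (sum \<gamma> K * sum \<delta> K)"
    unfolding double by (intro sum_mono pair)
  then show ?thesis by simp
qed

text \<open>
  The product of copies of \<open>K\<close> indexed by \<open>D\<close>. The value off \<open>D\<close> is a parameter because tableaux
  are extended by 0, where \<open>PiE\<close> would extend them by \<open>undefined\<close>.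
\<close>

definition box :: "'a set \<Rightarrow> 'b set \<Rightarrow> 'b \<Rightarrow> ('a \<Rightarrow> 'b) set" where
  "box D K c = {x. \<forall>a. (a \<in> D \<longrightarrow> x a \<in> K) \<and> (a \<notin> D \<longrightarrow> x a = c)}"

lemma finite_box: "finite D \<Longrightarrow> finite K \<Longrightarrow> finite (box D K c)"
  unfolding box_def by (rule finite_set_of_finite_funs)

lemma sum_box_insert:
  fixes f :: "('a \<Rightarrow> 'b) \<Rightarrow> real"
  assumes "a \<notin> D"
  shows "sum f (box (insert a D) K c) = (\<Sum>x\<in>box D K c. \<Sum>i\<in>K. f (x(a := i)))"
proof -
  have "bij_betw (\<lambda>(x, i). x(a := i)) (box D K c \<times> K) (box (insert a D) K c)"
    by (rule bij_betwI[where g = "\<lambda>x. (x(a := c), x a)"])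
      (use assms in \<open>auto simp: box_def fun_eq_iff\<close>)
  from sum.reindex_bij_betw[OF this, of f]
  show ?thesis by (simp add: sum.cartesian_product case_prod_beta)
qed

definition meet :: "('a \<Rightarrow> 'b::linorder) \<Rightarrow> ('a \<Rightarrow> 'b) \<Rightarrow> 'a \<Rightarrow> 'b" where
  "meet x y = (\<lambda>a. min (x a) (y a))"

definition join :: "('a \<Rightarrow> 'b::linorder) \<Rightarrow> ('a \<Rightarrow> 'b) \<Rightarrow> 'a \<Rightarrow> 'b" where
  "join x y = (\<lambda>a. max (x a) (y a))"

lemma meet_fun_upd: "meet (x(a := i)) (y(a := j)) = (meet x y)(a := min i j)"
  by (auto simp: meet_def)

lemma join_fun_upd: "join (x(a := i)) (y(a := j)) = (join x y)(a := max i j)"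
  by (auto simp: join_def)

text \<open>
  The hypothesis is inherited by the partial sums over one coordinate: for fixed remaining
  coordinates \<open>x\<close> and \<open>y\<close>, that is exactly the case of a single chain.
\<close>

theorem four_functions_box:
  fixes \<alpha> \<beta> \<gamma> \<delta> :: "('a \<Rightarrow> 'b::linorder) \<Rightarrow> real"
  assumes "finite D"
    and "\<And>x. 0 \<le> \<alpha> x" "\<And>x. 0 \<le> \<beta> x" "\<And>x. 0 \<le> \<gamma> x" "\<And>x. 0 \<le> \<delta> x"
    and "\<And>x y. x \<in> box D K c \<Longrightarrow> y \<in> box D K c \<Longrightarrow> \<alpha> x * \<beta> y \<le> \<gamma> (meet x y) * \<delta> (join x y)"
  shows "sum \<alpha> (box D K c) * sum \<beta> (box D K c) \<le> sum \<gamma> (box D K c) * sum \<delta> (box D K c)"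
  using assms
proof (induction D arbitrary: \<alpha> \<beta> \<gamma> \<delta> rule: finite_induct)
  case empty
  have "box {} K c = {\<lambda>_::'a. c}" by (auto simp: box_def)
  with empty.prems(5)[of "\<lambda>_. c" "\<lambda>_. c"] show ?case by (simp add: meet_def join_def)
next
  case (insert a D)
  have upd: "x(a := i) \<in> box (insert a D) K c" if "x \<in> box D K c" "i \<in> K" for x i
    using that by (auto simp: box_def)
  show ?case
    unfolding sum_box_insert[OF insert.hyps(2)]
  proof (rule insert.IH)
    fix x y assume "x \<in> box D K c" "y \<in> box D K c"
    then show "(\<Sum>i\<in>K. \<alpha> (x(a := i))) * (\<Sum>i\<in>K. \<beta> (y(a := i)))
        \<le> (\<Sum>i\<in>K. \<gamma> ((meet x y)(a := i))) * (\<Sum>i\<in>K. \<delta> ((join x y)(a := i)))"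
      by (intro four_functions_chain insert.prems)
        (metis insert.prems(5) upd meet_fun_upd join_fun_upd)
  qed (simp_all add: insert.prems sum_nonneg)
qed

text \<open>The four functions are the indicators of the four sets.\<close>

corollary card_mult_le_card_meets_joins:
  fixes X Y Z W :: "('a \<Rightarrow> 'b::linorder) set"
  assumes fin: "finite D" "finite K" "finite Z" "finite W"
    and sub: "X \<subseteq> box D K c" "Y \<subseteq> box D K c"
    and meet: "\<And>x y. x \<in> X \<Longrightarrow> y \<in> Y \<Longrightarrow> meet x y \<in> Z"
    and join: "\<And>x y. x \<in> X \<Longrightarrow> y \<in> Y \<Longrightarrow> join x y \<in> W"
  shows "card X * card Y \<le> card Z * card W"
proof -
  let ?B = "box D K c"
  have count: "(\<Sum>x\<in>?B. of_bool (x \<in> S)) = real (card (?B \<inter> S))" for S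
    using finite_box[OF fin(1,2), of c] by (simp add: of_bool_def sum.If_cases)
  have "(\<Sum>x\<in>?B. of_bool (x \<in> X)) * (\<Sum>x\<in>?B. of_bool (x \<in> Y))
      \<le> (\<Sum>x\<in>?B. of_bool (x \<in> Z)) * (\<Sum>x\<in>?B. of_bool (x \<in> W) :: real)"
    using meet join by (intro four_functions_box fin) auto
  moreover have "?B \<inter> X = X" "?B \<inter> Y = Y" using sub by auto
  ultimately have "card X * card Y \<le> card (?B \<inter> Z) * card (?B \<inter> W)"
    unfolding count by (simp flip: of_nat_mult)
  also have "\<dots> \<le> card Z * card W"
    by (intro mult_le_mono card_mono fin) auto
  finally show ?thesis .
qed

section \<open>Tableaux with bounded entries\<close>

definition bounded_SSYT :: "nat list \<Rightarrow> nat \<Rightarrow> (nat \<times> nat \<Rightarrow> nat) set" where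
  "bounded_SSYT l n = {T \<in> SSYT l. \<forall>b. T b \<le> n}"

lemma bounded_SSYTD:
  assumes "T \<in> bounded_SSYT l n"
  shows "T b \<le> n"
    and "b \<notin> young_diagram l \<Longrightarrow> T b = 0"
    and "b \<in> young_diagram l \<Longrightarrow> 1 \<le> T b"
    and "(i, j) \<in> young_diagram l \<Longrightarrow> (i, j') \<in> young_diagram l \<Longrightarrow> j < j' \<Longrightarrow> T (i, j) \<le> T (i, j')"
    and "(i, j) \<in> young_diagram l \<Longrightarrow> (i', j) \<in> young_diagram l \<Longrightarrow> i < i' \<Longrightarrow> T (i, j) < T (i', j)"
  using assms unfolding bounded_SSYT_def SSYT_def by blast+

lemma bounded_SSYTI:
  assumes "\<And>b. T b \<le> n"
    and "\<And>b. b \<notin> young_diagram l \<Longrightarrow> T b = 0"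
    and "\<And>b. b \<in> young_diagram l \<Longrightarrow> 1 \<le> T b"
    and "\<And>i j j'. (i, j) \<in> young_diagram l \<Longrightarrow> (i, j') \<in> young_diagram l \<Longrightarrow> j < j' \<Longrightarrow>
      T (i, j) \<le> T (i, j')"
    and "\<And>i i' j. (i, j) \<in> young_diagram l \<Longrightarrow> (i', j) \<in> young_diagram l \<Longrightarrow> i < i' \<Longrightarrow>
      T (i, j) < T (i', j)"
  shows "T \<in> bounded_SSYT l n"
  using assms unfolding bounded_SSYT_def SSYT_def by blast

lemma bounded_SSYT_subset_box:
  assumes "n \<le> m"
  shows "bounded_SSYT l n \<subseteq> box (young_diagram l) {..m} 0"
  unfolding box_def using bounded_SSYTD(1,2) assms by (fastforce intro: order_trans)

lemma finite_bounded_SSYT: "finite (bounded_SSYT l n)"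
  by (rule finite_subset[OF bounded_SSYT_subset_box[OF order_refl] finite_box])
    (simp_all add: finite_young_diagram)

lemma schur_ones_eq_card: "schur l (ones n) = real (card (bounded_SSYT l n))"
proof -
  have monomial: "(\<Prod>b\<in>young_diagram l. ones n (T b)) = of_bool (\<forall>b. T b \<le> n)"
    if "T \<in> SSYT l" for T
  proof (cases "\<forall>b. T b \<le> n")
    case True
    then have "\<And>b. ones n (T b) = 1" by (simp add: ones_def del: split_paired_All)
    with True show ?thesis by (simp del: split_paired_All)
  next
    case False
    then obtain b where b: "\<not> T b \<le> n" by blast
    \<comment> \<open>entries off the diagram are 0, so an entry above \<open>n\<close> lies on it\<close>
    moreover have "T b = 0" if "b \<notin> young_diagram l"
      using \<open>T \<in> SSYT l\<close> that unfolding SSYT_def by blast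
    ultimately have "b \<in> young_diagram l" by fastforce
    moreover have "ones n (T b) = 0" using b by (simp add: ones_def)
    ultimately have "(\<Prod>b\<in>young_diagram l. ones n (T b)) = 0"
      by (intro prod_zero finite_young_diagram) blast
    with False show ?thesis by (simp del: split_paired_All)
  qed
  have "schur l (ones n) = (\<Sum>\<^sub>\<infinity>T\<in>SSYT l. of_bool (\<forall>b. T b \<le> n))"
    unfolding schur_def by (intro infsum_cong monomial)
  also have "\<dots> = (\<Sum>\<^sub>\<infinity>T\<in>bounded_SSYT l n. 1)"
    by (rule infsum_cong_neutral) (auto simp: bounded_SSYT_def)
  finally show ?thesis by (simp add: finite_bounded_SSYT)
qed

definition raise :: "nat list \<Rightarrow> (nat \<times> nat \<Rightarrow> nat) \<Rightarrow> nat \<times> nat \<Rightarrow> nat" where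
  "raise l T b = (if b \<in> young_diagram l then Suc (T b) else 0)"

lemma raise_mem_box:
  assumes "S \<in> bounded_SSYT l n" "n < m"
  shows "raise l S \<in> box (young_diagram l) {..m} 0"
  using le_less_trans[OF bounded_SSYTD(1)[OF assms(1)] assms(2)]
  by (simp add: box_def raise_def Suc_le_eq)

lemma inj_on_raise: "inj_on (raise l) (bounded_SSYT l n)"
proof (rule inj_onI)
  fix S T
  assume mem: "S \<in> bounded_SSYT l n" "T \<in> bounded_SSYT l n" and eq: "raise l S = raise l T"
  show "S = T"
  proof
    fix b
    show "S b = T b"
      using mem[THEN bounded_SSYTD(2), of b] fun_cong[OF eq, of b]
      by (cases "b \<in> young_diagram l") (simp_all add: raise_def)
  qed
qed

lemma meet_raise_mem:
  assumes S: "S \<in> bounded_SSYT l n" and T: "T \<in> bounded_SSYT l m"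
  shows "meet (raise l S) T \<in> bounded_SSYT l (n + 1)"
proof (rule bounded_SSYTI)
  show "meet (raise l S) T b \<le> n + 1" for b
    using bounded_SSYTD(1)[OF S, of b] by (simp add: meet_def raise_def min_le_iff_disj)
  show "meet (raise l S) T b = 0" if "b \<notin> young_diagram l" for b
    using that by (simp add: meet_def raise_def)
  show "1 \<le> meet (raise l S) T b" if "b \<in> young_diagram l" for b
    using bounded_SSYTD(3)[OF T that] that by (simp add: meet_def raise_def)
  fix i j i' j'
  show "meet (raise l S) T (i, j) \<le> meet (raise l S) T (i, j')"
    if "(i, j) \<in> young_diagram l" "(i, j') \<in> young_diagram l" "j < j'"
    using bounded_SSYTD(4)[OF S that] bounded_SSYTD(4)[OF T that] that
    by (simp add: meet_def raise_def min_def)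
  show "meet (raise l S) T (i, j) < meet (raise l S) T (i', j)"
    if "(i, j) \<in> young_diagram l" "(i', j) \<in> young_diagram l" "i < i'"
    using bounded_SSYTD(5)[OF S that] bounded_SSYTD(5)[OF T that] that
    by (simp add: meet_def raise_def min_def)
qed

text \<open>
  Lowering the join by one on the diagram gives the maximum of \<open>S\<close> and of \<open>T\<close> lowered by one. Its
  entries are positive because those of \<open>S\<close> are, and lowering \<open>T\<close> keeps the strict inequalities
  down its columns because all entries of \<open>T\<close> are positive.
\<close>

lemma join_raise_mem:
  assumes S: "S \<in> bounded_SSYT l n" and T: "T \<in> bounded_SSYT l (m + 1)" and "n \<le> m"
  shows "join (raise l S) T \<in> raise l ` bounded_SSYT l m"
proof
  let ?U = "\<lambda>b. max (S b) (T b - 1)"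
  show "join (raise l S) T = raise l ?U"
  proof
    fix b
    show "join (raise l S) T b = raise l ?U b"
      using bounded_SSYTD(2)[OF T, of b] by (auto simp: join_def raise_def max_def)
  qed
  show "?U \<in> bounded_SSYT l m"
  proof (rule bounded_SSYTI)
    show "?U b \<le> m" for b
      using bounded_SSYTD(1)[OF S, of b] bounded_SSYTD(1)[OF T, of b] \<open>n \<le> m\<close> by simp
    show "?U b = 0" if "b \<notin> young_diagram l" for b
      using bounded_SSYTD(2)[OF S that] bounded_SSYTD(2)[OF T that] by simp
    show "1 \<le> ?U b" if "b \<in> young_diagram l" for b
      using bounded_SSYTD(3)[OF S that] by simp
    fix i j i' j'
    show "?U (i, j) \<le> ?U (i, j')"
      if "(i, j) \<in> young_diagram l" "(i, j') \<in> young_diagram l" "j < j'"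
      using bounded_SSYTD(4)[OF S that] bounded_SSYTD(4)[OF T that] by linarith
    show "?U (i, j) < ?U (i', j)"
      if "(i, j) \<in> young_diagram l" "(i', j) \<in> young_diagram l" "i < i'"
      using bounded_SSYTD(5)[OF S that] bounded_SSYTD(5)[OF T that] bounded_SSYTD(3)[OF T that(1)]
      by linarith
  qed
qed

lemma card_bounded_SSYT_log_concave:
  "card (bounded_SSYT l n) * card (bounded_SSYT l (n + 2)) \<le> (card (bounded_SSYT l (n + 1)))\<^sup>2"
proof -
  let ?A = "bounded_SSYT l"
  have "card (raise l ` ?A n) * card (?A (n + 2))
      \<le> card (?A (n + 1)) * card (raise l ` ?A (n + 1))"
  proof (rule card_mult_le_card_meets_joins)
    show "raise l ` ?A n \<subseteq> box (young_diagram l) {..n + 2} 0"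
      by (rule image_subsetI, erule raise_mem_box) linarith
    show "?A (n + 2) \<subseteq> box (young_diagram l) {..n + 2} 0"
      by (rule bounded_SSYT_subset_box) simp
    fix S' T assume "S' \<in> raise l ` ?A n" and T: "T \<in> ?A (n + 2)"
    then obtain S where S: "S \<in> ?A n" "S' = raise l S" by blast
    show "meet S' T \<in> ?A (n + 1)"
      using meet_raise_mem[OF S(1) T] S(2) by simp
    show "join S' T \<in> raise l ` ?A (n + 1)"
      using join_raise_mem[OF S(1), of T "n + 1"] T S(2) by simp
  qed (simp_all add: finite_young_diagram finite_bounded_SSYT)
  then show ?thesis by (simp add: card_image[OF inj_on_raise] power2_eq_square)
qed

theorem corollary4p3:
  fixes l :: "nat list"
  assumes "is_partition l"
  shows "\<forall>n\<ge>1. (schur l (ones n))\<^sup>2 \<ge> schur l (ones (n - 1)) * schur l (ones (n + 1))"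
proof (intro allI impI)
  fix n :: nat assume "n \<ge> 1"
  then obtain m where n: "n = m + 1" by (metis le_add_diff_inverse2)
  show "(schur l (ones n))\<^sup>2 \<ge> schur l (ones (n - 1)) * schur l (ones (n + 1))"
    using card_bounded_SSYT_log_concave[of l m]
    by (simp add: n schur_ones_eq_card flip: of_nat_mult of_nat_power)
qed

end
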